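(* Let $A=R/I$ be a one-dimensional Gorenstein graded $\mathbf k$-algebra ($I$ a homogeneous ideal of $R$), whose inverse system $I^\perp$ contains a set $\mathcal F=\{F_l\}_{l\in\mathbb N_+}$. Let $z\in R$ be a linear form which is a non-zero divisor of $A$. Suppose that $\mathcal F$ satisfies the following conditions: (1) for all $l\in\mathbb N_+$, $z\circ F_l=F_{l-1}$ if $l>1$, and $z\circ F_1=0$; (2) $\deg(F_1)$ agrees with the socle degree of $A$. Then there exist non-zero elements $\alpha_l\in\mathbf k^*$, $l\in\mathbb N_+$, such that $\mathcal F'=\{\frac1{\alpha_l}F_l;\ l\in\mathbb N_+\}$ is $G$-admissible with respect to $z$; in particular $\mathcal F$ (and $\mathcal F'$) is a system of generators of $I^\perp$.
   Context: $\mathbf k$ is an algebraically closed field of characteristic zero, $R=\mathbf k[x_1,\dots,x_n]$ (standard graded) and $\Gamma=\mathbf k[y_1,\dots,y_n]$. $R$ acts on $\Gamma$ by differentiation: $f\circ g=f(\partial_{y_1},\dots,\partial_{y_n})(g)$, making $\Gamma$ an $R$-module. $\langle G_j\rangle$ denotes the $R$-submodule of $\Gamma$ generated by elements $G_j$. The inverse system of an ideal $I\subset R$ is $I^\perp=\{G\in\Gamma: I\circ G=0\}$; for a submodule $W\subset\Gamma$, $\operatorname{Ann}_R(W)=\{g\in R: g\circ G=0\ \forall G\in W\}$. The socle degree of a one-dimensional Gorenstein graded algebra $A$ is the largest $t$ with $(A/zA)_t\ne0$, for $z$ a linear non-zero divisor of $A$ (it does not depend on $z$). A family $\{F_l\}_{l\in\mathbb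 N_+}$ in $\Gamma$ is $G$-admissible with respect to a linear form $z\in R$ if: (1) $z\circ F_l=F_{l-1}$ for $l>1$ and $z\circ F_1=0$; (2) $\operatorname{Ann}_R(\langle F_l\rangle)\circ F_{l+1}=\langle F_1\rangle$ for all $l\in\mathbb N_+$. *)

theory Defs
  imports
    "HOL-Library.Poly_Mapping"
    "HOL-Library.Extended_Nat"
    "HOL-Library.Extended_Real"
    "HOL-Computational_Algebra.Polynomial"
begin

text \<open>
  Polynomials over \<open>'k\<close> in finitely many variables indexed by \<open>'n\<close>; an exponent vector is a
  finitely supported map \<open>'n \<Rightarrow> nat\<close>. The same type serves for \<open>R\<close> (variables \<open>x\<close>) and for
  \<open>\<Gamma>\<close> (variables \<open>y\<close>).
\<close>

type_synonym ('n, 'k) mpoly = "('n \<Rightarrow>\<^sub>0 nat) \<Rightarrow>\<^sub>0 'k"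

definition var :: "'n \<Rightarrow> ('n, 'k::field) mpoly" where
  "var i = Poly_Mapping.single (Poly_Mapping.single i 1) 1"

definition const :: "'k \<Rightarrow> ('n, 'k::field) mpoly" where
  "const c = Poly_Mapping.single 0 c"

definition mon_degree :: "('n::finite \<Rightarrow>\<^sub>0 nat) \<Rightarrow> nat" where
  "mon_degree a = (\<Sum>i\<in>UNIV. Poly_Mapping.lookup a i)"

text \<open>The supremum over the empty set gives \<open>total_degree 0 = -\<infinity>\<close>.\<close>

definition total_degree :: "('n::finite, 'k::field) mpoly \<Rightarrow> ereal" where
  "total_degree g = (SUP a\<in>Poly_Mapping.keys g. ereal (real (mon_degree a)))"

definition homogeneous :: "nat \<Rightarrow> ('n::finite, 'k::field) mpoly \<Rightarrow> bool" where
  "homogeneous d f \<longleftrightarrow> (\<forall>a\<in>Poly_Mapping.keys f. mon_degree a = d)"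

abbreviation linear_form :: "('n::finite, 'k::field) mpoly \<Rightarrow> bool" where
  "linear_form \<equiv> homogeneous 1"


section \<open>The differentiation action\<close>

definition partial :: "'n::finite \<Rightarrow> ('n, 'k::field) mpoly \<Rightarrow> ('n, 'k) mpoly" where
  "partial i g = (\<Sum>b\<in>Poly_Mapping.keys g.
     Poly_Mapping.single (b - Poly_Mapping.single i 1)
       (of_nat (Poly_Mapping.lookup b i) * Poly_Mapping.lookup g b))"

text \<open>
  The fold composes the operators \<open>partial i ^^ a i\<close> over all variables; the order is irrelevant
  by \<open>partial_commute\<close> below.
\<close>

definition partial_mon :: "('n::finite \<Rightarrow>\<^sub>0 nat) \<Rightarrow> ('n, 'k::field) mpoly \<Rightarrow> ('n, 'k) mpoly" where
  "partial_mon a g = Finite_Set.fold (\<lambda>i. partial i ^^ Poly_Mapping.lookup a i) g UNIV"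

definition act :: "('n::finite, 'k::field) mpoly \<Rightarrow> ('n, 'k) mpoly \<Rightarrow> ('n, 'k) mpoly" where
  "act f g = (\<Sum>a\<in>Poly_Mapping.keys f. const (Poly_Mapping.lookup f a) * partial_mon a g)"

lemma lookup_const_mult [simp]:
  "Poly_Mapping.lookup (const c * g) a = c * Poly_Mapping.lookup g a"
  by (simp add: const_def flip: mult_map_scale_conv_mult)
     (simp add: Poly_Mapping.map.rep_eq when_def)

lemma lookup_partial:
  "Poly_Mapping.lookup (partial i g) c =
     of_nat (Suc (Poly_Mapping.lookup c i)) * Poly_Mapping.lookup g (c + Poly_Mapping.single i 1)"
proof -
  let ?e = "Poly_Mapping.single i (1::nat)"
  have eq: "Poly_Mapping.lookup (Poly_Mapping.single (b - ?e)
          (of_nat (Poly_Mapping.lookup b i) * Poly_Mapping.lookup g b)) c =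
        (if b = c + ?e then of_nat (Poly_Mapping.lookup b i) * Poly_Mapping.lookup g b else 0)" for b
  proof (cases "Poly_Mapping.lookup b i = 0")
    case True
    then show ?thesis by (auto simp: lookup_single)
  next
    case False
    then have "b - ?e + ?e = b"
      by (intro poly_mapping_eqI) (auto simp: lookup_add lookup_minus lookup_single when_def)
    then have "b - ?e = c \<longleftrightarrow> b = c + ?e"
      by (metis add_diff_cancel_right')
    then show ?thesis by (auto simp: lookup_single when_def)
  qed
  have "Poly_Mapping.lookup (partial i g) c =
    (\<Sum>b\<in>Poly_Mapping.keys g. if b = c + ?e
        then of_nat (Poly_Mapping.lookup b i) * Poly_Mapping.lookup g b else 0)"
    by (simp only: partial_def lookup_sum eq)
  also have "\<dots> = of_nat (Poly_Mapping.lookup (c + ?e) i) * Poly_Mapping.lookup g (c + ?e)"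
    by (simp add: sum.delta' in_keys_iff)
  finally show ?thesis by (simp add: lookup_add)
qed

lemma partial_add: "partial i (g + h) = partial i g + partial i h"
  by (rule poly_mapping_eqI) (simp add: lookup_partial lookup_add algebra_simps)

lemma partial_const_mult: "partial i (const c * g) = const c * partial i g"
  by (rule poly_mapping_eqI) (simp add: lookup_partial)

lemma partial_commute: "partial i (partial j g) = partial j (partial i g)"
proof (cases "i = j")
  case False
  then show ?thesis
    by (intro poly_mapping_eqI)
       (simp add: lookup_partial lookup_add lookup_single when_def ac_simps)
qed simp

lemma funpow_partial_add:
  "(partial i ^^ m) (g + h) = (partial i ^^ m) g + (partial i ^^ m) h"
  by (induction m) (simp_all add: partial_add)

lemma funpow_partial_const_mult:
  "(partial i ^^ m) (const c * g) = const c * (partial i ^^ m) g"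
  by (induction m) (simp_all add: partial_const_mult)

lemma funpow_partial_commute:
  "(partial i ^^ m) ((partial j ^^ l) g) = (partial j ^^ l) ((partial i ^^ m) g)"
proof -
  have *: "partial i ((partial j ^^ l) h) = (partial j ^^ l) (partial i h)" for h
    by (induction l) (simp_all add: partial_commute[of i j])
  show ?thesis by (induction m) (simp_all add: *)
qed

lemma comp_fun_commute_on_partial: "comp_fun_commute_on UNIV (\<lambda>i. partial i ^^ f i)"
  by standard (auto simp: fun_eq_iff funpow_partial_commute)

lemma fold_partial_facts:
  fixes S :: "'n::finite set" and g h :: "('n, 'k::field) mpoly"
  shows "Finite_Set.fold (\<lambda>i. partial i ^^ f i) (g + h) S =
           Finite_Set.fold (\<lambda>i. partial i ^^ f i) g S + Finite_Set.fold (\<lambda>i. partial i ^^ f i) h S"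
    and "Finite_Set.fold (\<lambda>i. partial i ^^ f i) (const c * g) S =
           const c * Finite_Set.fold (\<lambda>i. partial i ^^ f i) g S"
    and "Finite_Set.fold (\<lambda>i. partial i ^^ f i) ((partial j ^^ m) g) S =
           (partial j ^^ m) (Finite_Set.fold (\<lambda>i. partial i ^^ f i) g S)"
    and "Finite_Set.fold (\<lambda>i. partial i ^^ (f i + f' i)) g S =
           Finite_Set.fold (\<lambda>i. partial i ^^ f i) (Finite_Set.fold (\<lambda>i. partial i ^^ f' i) g S) S"
proof -
  note ins = comp_fun_commute_on.fold_insert[OF comp_fun_commute_on_partial]
  have fin: "finite S" by simp
  show "Finite_Set.fold (\<lambda>i. partial i ^^ f i) (g + h) S =
           Finite_Set.fold (\<lambda>i. partial i ^^ f i) g S + Finite_Set.fold (\<lambda>i. partial i ^^ f i) h S"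
    using fin by induction (simp_all add: ins funpow_partial_add)
  show "Finite_Set.fold (\<lambda>i. partial i ^^ f i) (const c * g) S =
           const c * Finite_Set.fold (\<lambda>i. partial i ^^ f i) g S"
    using fin by induction (simp_all add: ins funpow_partial_const_mult)
  have comm: "Finite_Set.fold (\<lambda>i. partial i ^^ f i) ((partial j ^^ m) g) S =
           (partial j ^^ m) (Finite_Set.fold (\<lambda>i. partial i ^^ f i) g S)"
    for j m and g :: "('n, 'k) mpoly" and S
    using finite[of S] by induction (simp_all add: ins funpow_partial_commute)
  show "Finite_Set.fold (\<lambda>i. partial i ^^ f i) ((partial j ^^ m) g) S =
           (partial j ^^ m) (Finite_Set.fold (\<lambda>i. partial i ^^ f i) g S)"
    by (rule comm)
  show "Finite_Set.fold (\<lambda>i. partial i ^^ (f i + f' i)) g S =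
           Finite_Set.fold (\<lambda>i. partial i ^^ f i) (Finite_Set.fold (\<lambda>i. partial i ^^ f' i) g S) S"
    using fin
    by induction (simp_all add: ins comm, simp add: funpow_add funpow_partial_commute)
qed

lemma partial_mon_add: "partial_mon a (g + h) = partial_mon a g + partial_mon a h"
  and partial_mon_const_mult: "partial_mon a (const c * g) = const c * partial_mon a g"
  and partial_mon_plus: "partial_mon (a + b) g = partial_mon a (partial_mon b g)"
  by (simp_all add: partial_mon_def fold_partial_facts lookup_add)

lemma partial_mon_zero [simp]: "partial_mon 0 g = g"
proof -
  have "Finite_Set.fold (\<lambda>i. partial i ^^ f i) g S = g" if "\<And>i. f i = 0" for f and S :: "'a set"
    using finite[of S]
  proof induction
    case (insert x F)
    then have "Finite_Set.fold (\<lambda>i. partial i ^^ f i) g (insert x F) =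
        (partial x ^^ f x) (Finite_Set.fold (\<lambda>i. partial i ^^ f i) g F)"
      by (intro comp_fun_commute_on.fold_insert[OF comp_fun_commute_on_partial]) auto
    also have "\<dots> = (partial x ^^ 0) g"
      by (simp only: insert.IH) (simp only: that)
    finally show ?case by simp
  qed simp
  from this[of "Poly_Mapping.lookup 0"] show ?thesis by (simp add: partial_mon_def)
qed

lemma partial_mon_single [simp]: "partial_mon (Poly_Mapping.single i 1) g = partial i g"
proof -
  have "Finite_Set.fold (\<lambda>j. partial j ^^ Poly_Mapping.lookup (Poly_Mapping.single i 1) j) g S =
      (if i \<in> S then partial i g else g)" for S
    using finite[of S]
    by induction
       (auto simp: comp_fun_commute_on.fold_insert[OF comp_fun_commute_on_partial] lookup_single when_def)
  then show ?thesis by (simp add: partial_mon_def)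
qed

lemma const_zero [simp]: "const 0 = 0"
  and const_one [simp]: "const 1 = 1"
  and const_add: "const (c + d) = const c + const d"
  and const_mult: "const (c * d) = const c * const d"
  by (simp_all add: const_def single_add mult_single)

lemma act_superset:
  assumes "finite S" "Poly_Mapping.keys f \<subseteq> S"
  shows "act f g = (\<Sum>a\<in>S. const (Poly_Mapping.lookup f a) * partial_mon a g)"
  unfolding act_def using assms by (intro sum.mono_neutral_left) (auto simp: in_keys_iff)

lemma act_single: "act (Poly_Mapping.single a c) g = const c * partial_mon a g"
  by (subst act_superset[of "{a}"]) auto

lemma act_var: "act (var i) g = partial i g"
  unfolding var_def by (simp only: act_single partial_mon_single const_one mult_1_left)

lemma act_add_left: "act (f + f') g = act f g + act f' g"
proof -
  let ?S = "Poly_Mapping.keys f \<union> Poly_Mapping.keys f'"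
  have "Poly_Mapping.keys (f + f') \<subseteq> ?S" by (rule keys_add)
  then show ?thesis
    by (simp add: act_superset[of ?S] lookup_add const_add algebra_simps sum.distrib)
qed

lemma act_add_right: "act f (g + h) = act f g + act f h"
  by (simp add: act_def partial_mon_add algebra_simps sum.distrib)

lemma act_zero_left [simp]: "act 0 g = 0"
  by (simp add: act_def)

lemma act_zero_right [simp]: "act f 0 = 0"
  using act_add_right[of f 0 0] by simp

lemma act_sum_left: "act (sum f S) g = (\<Sum>a\<in>S. act (f a) g)"
  by (induction S rule: infinite_finite_induct) (simp_all add: act_add_left)

lemma act_sum_right: "act f (sum g S) = (\<Sum>a\<in>S. act f (g a))"
  by (induction S rule: infinite_finite_induct) (simp_all add: act_add_right)

lemma poly_mapping_sum_singles:
  "(\<Sum>a\<in>Poly_Mapping.keys f. Poly_Mapping.single a (Poly_Mapping.lookup f a)) = f"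
  by (rule poly_mapping_eqI)
     (simp add: lookup_sum lookup_single when_def in_keys_iff)

lemma act_mult: "act (f * f') g = act f (act f' g)"
proof -
  let ?s = "\<lambda>f a. Poly_Mapping.single a (Poly_Mapping.lookup f a)"
  have *: "act (?s f a * ?s f' b) g = act (?s f a) (act (?s f' b) g)" for a b
    by (simp add: mult_single act_single partial_mon_plus partial_mon_const_mult const_mult mult.assoc)
  have "f * f' = (\<Sum>a\<in>Poly_Mapping.keys f. \<Sum>b\<in>Poly_Mapping.keys f'. ?s f a * ?s f' b)"
    by (simp add: sum_product[symmetric] poly_mapping_sum_singles)
  then have "act (f * f') g =
      act (\<Sum>a\<in>Poly_Mapping.keys f. ?s f a) (act (\<Sum>b\<in>Poly_Mapping.keys f'. ?s f' b) g)"
    by (simp only: act_sum_left act_sum_right *) (rule sum.swap)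
  then show ?thesis by (simp only: poly_mapping_sum_singles)
qed

lemma act_one [simp]: "act 1 g = g"
  using act_single[of 0 1 g] by simp

lemma module_act: "module act"
  by standard (simp_all add: act_add_left act_add_right act_mult)

lemma module_ring: "module ((*) :: 'a::comm_ring_1 \<Rightarrow> 'a \<Rightarrow> 'a)"
  by standard (simp_all add: algebra_simps)

definition submodule_generated :: "('n::finite, 'k::field) mpoly set \<Rightarrow> ('n, 'k) mpoly set" where
  "submodule_generated W = module.span act W"

definition inverse_system :: "('n::finite, 'k::field) mpoly set \<Rightarrow> ('n, 'k) mpoly set" where
  "inverse_system I = {G. \<forall>f\<in>I. act f G = 0}"

definition annihilator :: "('n::finite, 'k::field) mpoly set \<Rightarrow> ('n, 'k) mpoly set" where
  "annihilator W = {f. \<forall>G\<in>W. act f G = 0}"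

text \<open>Families are indexed by the positive integers; the value at \<open>0\<close> plays no role.\<close>

definition G_admissible ::
    "('n::finite, 'k::field) mpoly \<Rightarrow> (nat \<Rightarrow> ('n, 'k) mpoly) \<Rightarrow> bool" where
  "G_admissible z F \<longleftrightarrow> linear_form z \<and>
     (\<forall>l>1. act z (F l) = F (l - 1)) \<and> act z (F 1) = 0 \<and>
     (\<forall>l\<ge>1. (\<lambda>f. act f (F (l + 1))) ` annihilator (submodule_generated {F l})
              = submodule_generated {F 1})"


section \<open>Graded quotients of the polynomial ring\<close>

text \<open>The algebra \<open>A = R/I\<close> is represented by the ideal \<open>I\<close>.\<close>

definition is_ideal :: "'a::comm_ring_1 set \<Rightarrow> bool" where
  "is_ideal I = module.subspace (*) I"

definition ideal_generated :: "'a::comm_ring_1 set \<Rightarrow> 'a set" where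
  "ideal_generated S = module.span (*) S"

definition homogeneous_ideal :: "('n::finite, 'k::field) mpoly set \<Rightarrow> bool" where
  "homogeneous_ideal I \<longleftrightarrow> (\<exists>S. (\<forall>f\<in>S. \<exists>d. homogeneous d f) \<and> I = ideal_generated S)"

definition prime_ideal :: "'a::comm_ring_1 set \<Rightarrow> bool" where
  "prime_ideal P \<longleftrightarrow> is_ideal P \<and> P \<noteq> UNIV \<and> (\<forall>a b. a * b \<in> P \<longrightarrow> a \<in> P \<or> b \<in> P)"

text \<open>
  Krull dimension of \<open>R/I\<close>; primes of \<open>R/I\<close> correspond to primes of \<open>R\<close> containing \<open>I\<close>.
\<close>

definition quotient_dim :: "'a::comm_ring_1 set \<Rightarrow> enat" where
  "quotient_dim I = (SUP Ps \<in> {Ps. Ps \<noteq> [] \<and> sorted_wrt (\<subset>) Ps \<and>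
                        (\<forall>P\<in>set Ps. prime_ideal P \<and> I \<subseteq> P)}. enat (length Ps - 1))"

definition quotient_nonzerodivisor :: "'a::comm_ring_1 set \<Rightarrow> 'a \<Rightarrow> bool" where
  "quotient_nonzerodivisor I z \<longleftrightarrow> z \<notin> I \<and> (\<forall>f. z * f \<in> I \<longrightarrow> f \<in> I)"

definition quotient_regular_sequence :: "'a::comm_ring_1 set \<Rightarrow> 'a list \<Rightarrow> bool" where
  "quotient_regular_sequence I \<theta> \<longleftrightarrow> ideal_generated (I \<union> set \<theta>) \<noteq> UNIV \<and>
     (\<forall>j<length \<theta>. quotient_nonzerodivisor (ideal_generated (I \<union> set (take j \<theta>))) (\<theta> ! j))"

text \<open>
  Preimage in \<open>R\<close> of the socle \<open>(0 : m)\<close> of \<open>R/J\<close>, where \<open>m\<close> is the ideal generated by the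
  variables.
\<close>

definition socle :: "('n::finite, 'k::field) mpoly set \<Rightarrow> ('n, 'k) mpoly set" where
  "socle J = {f. \<forall>i. var i * f \<in> J}"

text \<open>\<open>dim\<^sub>k (socle J / J) = 1\<close>.\<close>

definition socle_one_dimensional :: "('n::finite, 'k::field) mpoly set \<Rightarrow> bool" where
  "socle_one_dimensional J \<longleftrightarrow>
     (\<exists>s\<in>socle J - J. \<forall>f\<in>socle J. \<exists>c. f - const c * s \<in> J)"

text \<open>
  \<open>R/I\<close> is Gorenstein: Cohen--Macaulay of type one, that is, there is a homogeneous regular
  sequence of length \<open>dim R/I\<close> such that the quotient by it has one-dimensional socle.
\<close>

definition gorenstein_graded :: "('n::finite, 'k::field) mpoly set \<Rightarrow> bool" where
  "gorenstein_graded I \<longleftrightarrow> homogeneous_ideal I \<and>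
     (\<exists>\<theta>. (\<forall>t\<in>set \<theta>. \<exists>d>0. homogeneous d t) \<and>
          quotient_regular_sequence I \<theta> \<and>
          enat (length \<theta>) = quotient_dim I \<and>
          socle_one_dimensional (ideal_generated (I \<union> set \<theta>)))"

text \<open>
  Largest degree \<open>t\<close> with \<open>(A/zA)\<^sub>t \<noteq> 0\<close>, where \<open>A = R/I\<close> and \<open>z\<close> is a linear non-zero-divisor
  of \<open>A\<close>. For one-dimensional Gorenstein \<open>A\<close> it does not depend on the choice of \<open>z\<close>.
\<close>

definition socle_degree :: "('n::finite, 'k::field) mpoly set \<Rightarrow> ('n, 'k) mpoly \<Rightarrow> nat" where
  "socle_degree I z =
     (GREATEST t. \<exists>f. homogeneous t f \<and> f \<notin> ideal_generated (I \<union> {z}))"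

end

theory Submission
  imports Defs
begin

text \<open>
  Write \<open>J = (I, z)\<close>. Since \<open>R/J\<close> is artinian with one-dimensional socle in degree \<open>s\<close>, an element
  \<open>G\<close> of \<open>J\<^sup>\<bottom>\<close> of degree \<open>s\<close> has annihilator exactly \<open>J\<close>, and by duality it generates \<open>J\<^sup>\<bottom>\<close>.
  So \<open>\<langle>F\<^sub>1\<rangle>\<close> consists of all elements of \<open>I\<^sup>\<bottom>\<close> killed by \<open>z\<close>. If \<open>f\<close> kills \<open>F\<^sub>l\<close>, then \<open>z\<close> kills
  \<open>f \<circ> F\<^bsub>l+1\<^esub>\<close>, which is therefore in \<open>\<langle>F\<^sub>1\<rangle>\<close>; conversely \<open>z\<^sup>l\<close> kills \<open>F\<^sub>l\<close> and maps \<open>F\<^bsub>l+1\<^esub>\<close>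
  to \<open>F\<^sub>1\<close>. Hence \<open>\<alpha>\<^sub>l = 1\<close> works. An element of \<open>I\<^sup>\<bottom>\<close> killed by \<open>z\<^bsup>l+1\<^esup>\<close> becomes, after
  subtracting a multiple of \<open>F\<^bsub>l+1\<^esub>\<close>, one killed by \<open>z\<^sup>l\<close>, which gives generation by induction.
\<close>

section \<open>Ideals\<close>

lemma is_ideal_zero: "is_ideal I \<Longrightarrow> 0 \<in> I"
  and is_ideal_add: "is_ideal I \<Longrightarrow> a \<in> I \<Longrightarrow> b \<in> I \<Longrightarrow> a + b \<in> I"
  and is_ideal_mult: "is_ideal I \<Longrightarrow> a \<in> I \<Longrightarrow> r * a \<in> I"
  unfolding is_ideal_def
  by (auto simp: module.subspace_def[OF module_ring])

lemma is_ideal_diff: "is_ideal I \<Longrightarrow> a \<in> I \<Longrightarrow> b \<in> I \<Longrightarrow> a - b \<in> I"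
  using is_ideal_add[of I a "-1 * b"] is_ideal_mult[of I b "-1"] by simp

lemma is_ideal_sum:
  "is_ideal I \<Longrightarrow> (\<And>x. x \<in> A \<Longrightarrow> f x \<in> I) \<Longrightarrow> sum f A \<in> I"
  by (induction A rule: infinite_finite_induct) (auto intro: is_ideal_zero is_ideal_add)

lemma is_idealI:
  assumes "0 \<in> I" "\<And>a b. a \<in> I \<Longrightarrow> b \<in> I \<Longrightarrow> a + b \<in> I" "\<And>r a. a \<in> I \<Longrightarrow> r * a \<in> I"
  shows "is_ideal I"
  unfolding is_ideal_def module.subspace_def[OF module_ring] using assms by blast

lemma is_ideal_generated: "is_ideal (ideal_generated S)"
  unfolding is_ideal_def ideal_generated_def by (rule module.subspace_span[OF module_ring])

lemma ideal_generated_superset: "S \<subseteq> ideal_generated S"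
  unfolding ideal_generated_def by (rule module.span_superset[OF module_ring])

lemma ideal_generated_minimal: "S \<subseteq> I \<Longrightarrow> is_ideal I \<Longrightarrow> ideal_generated S \<subseteq> I"
  unfolding is_ideal_def ideal_generated_def by (rule module.span_minimal[OF module_ring])

lemma ideal_generated_ideal: "is_ideal I \<Longrightarrow> ideal_generated I = I"
  by (simp add: ideal_generated_minimal ideal_generated_superset subset_antisym)

lemma mem_ideal_generated_insert:
  assumes "is_ideal I"
  shows "f \<in> ideal_generated (I \<union> {z}) \<longleftrightarrow> (\<exists>r. f - z * r \<in> I)"
  using module.span_breakdown_eq[OF module_ring, of f z I] ideal_generated_ideal[OF assms]
  by (simp add: ideal_generated_def mult.commute)

lemma prime_ideal_disjoint_exists:
  fixes I :: "'a::comm_ring_1 set"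
  assumes I: "is_ideal I" and one: "1 \<in> S" and mult: "\<And>a b. a \<in> S \<Longrightarrow> b \<in> S \<Longrightarrow> a * b \<in> S"
    and disj: "I \<inter> S = {}"
  obtains P where "prime_ideal P" "I \<subseteq> P" "P \<inter> S = {}"
proof -
  let ?A = "{P. is_ideal P \<and> I \<subseteq> P \<and> P \<inter> S = {}}"
  have "\<exists>M\<in>?A. \<forall>X\<in>?A. M \<subseteq> X \<longrightarrow> X = M"
  proof (rule subset_Zorn_nonempty)
    show "?A \<noteq> {}" using I disj by blast
  next
    fix C assume "C \<noteq> {}" and C: "subset.chain ?A C"
    then obtain P where P: "P \<in> C" by blast
    have sub: "C \<subseteq> ?A" using C by (simp add: subset_chain_def)
    have "is_ideal (\<Union>C)"
    proof (rule is_idealI)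
      show "0 \<in> \<Union>C" using P sub is_ideal_zero by blast
      show "a + b \<in> \<Union>C" if ab: "a \<in> \<Union>C" "b \<in> \<Union>C" for a b
      proof -
        obtain X Y where XY: "X \<in> C" "Y \<in> C" "a \<in> X" "b \<in> Y" using ab by blast
        then have "X \<subseteq> Y \<or> Y \<subseteq> X" using C by (auto simp: subset_chain_def)
        then obtain W where "W \<in> C" "a \<in> W" "b \<in> W" using XY by blast
        then show ?thesis using sub is_ideal_add by blast
      qed
      show "r * a \<in> \<Union>C" if "a \<in> \<Union>C" for r a using that sub is_ideal_mult by blast
    qed
    then show "\<Union>C \<in> ?A" using sub P by blast
  qed
  then obtain P where "P \<in> ?A" and P_max: "\<forall>X\<in>?A. P \<subseteq> X \<longrightarrow> X = P"
    by (rule bexE)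
  then have P: "is_ideal P" "I \<subseteq> P" "P \<inter> S = {}" by simp_all
  have max: "X = P" if "is_ideal X" "I \<subseteq> X" "X \<inter> S = {}" "P \<subseteq> X" for X
    using P_max that by simp
  have meets: "\<exists>s\<in>S. \<exists>r. s - a * r \<in> P" if "a \<notin> P" for a
  proof (rule ccontr)
    assume neg: "\<not> ?thesis"
    let ?X = "ideal_generated (P \<union> {a})"
    have "P \<subseteq> ?X" "a \<in> ?X" using ideal_generated_superset by blast+
    moreover have "?X \<inter> S = {}" using neg mem_ideal_generated_insert[OF P(1)] by blast
    ultimately have "?X = P" using max[of ?X] is_ideal_generated P(2) by blast
    with \<open>a \<in> ?X\<close> that show False by simp
  qed
  have "prime_ideal P"
    unfolding prime_ideal_def
  proof (intro conjI allI impI)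
    show "P \<noteq> UNIV" using P(3) one by blast
    fix a b assume ab: "a * b \<in> P"
    show "a \<in> P \<or> b \<in> P"
    proof (rule ccontr)
      assume "\<not> ?thesis"
      then obtain s r s' r' where s: "s \<in> S" "s - a * r \<in> P" "s' \<in> S" "s' - b * r' \<in> P"
        using meets by meson
      have "s * s' = s' * (s - a * r) + (a * r) * (s' - b * r') + (r * r') * (a * b)"
        by (simp add: algebra_simps)
      also have "\<dots> \<in> P"
        by (rule is_ideal_add[OF P(1) is_ideal_add[OF P(1)
              is_ideal_mult[OF P(1) s(2)] is_ideal_mult[OF P(1) s(4)]] is_ideal_mult[OF P(1) ab]])
      finally show False using mult[OF s(1) s(3)] P(3) by blast
    qed
  qed (fact P(1))
  with P that show ?thesis by blast
qed

lemma quotient_dim_chain: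
  assumes "prime_ideal P" "prime_ideal P'" "prime_ideal P''" "I \<subseteq> P" "P \<subset> P'" "P' \<subset> P''"
  shows "2 \<le> quotient_dim I"
proof -
  have "enat (length [P, P', P''] - 1) \<le> quotient_dim I"
    unfolding quotient_dim_def using assms by (intro SUP_upper) auto
  then show ?thesis by (simp add: numeral_eq_enat eval_nat_numeral)
qed


section \<open>Monomials and homogeneous components\<close>

lemma mon_degree_add: "mon_degree (a + b) = mon_degree a + mon_degree b"
  by (simp add: mon_degree_def lookup_add sum.distrib)

lemma mon_degree_eq_0_iff [simp]: "mon_degree a = 0 \<longleftrightarrow> a = 0"
  by (auto simp: mon_degree_def poly_mapping_eq_iff fun_eq_iff)

lemma mon_degree_single [simp]: "mon_degree (Poly_Mapping.single i k) = k"
  by (simp add: mon_degree_def lookup_single when_def)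

lemma mon_split:
  fixes a :: "'n \<Rightarrow>\<^sub>0 nat"
  assumes "k \<le> Poly_Mapping.lookup a i"
  obtains b where "a = Poly_Mapping.single i k + b"
proof
  show "a = Poly_Mapping.single i k + (a - Poly_Mapping.single i k)"
    using assms by (intro poly_mapping_eqI) (auto simp: lookup_add lookup_minus lookup_single when_def)
qed

lemma mon_nonzero_split:
  assumes "a \<noteq> (0 :: 'n \<Rightarrow>\<^sub>0 nat)"
  obtains i b where "a = Poly_Mapping.single i 1 + b"
proof -
  obtain i where "Poly_Mapping.lookup a i \<noteq> 0"
    using assms by (auto simp: poly_mapping_eq_iff fun_eq_iff)
  then show ?thesis using mon_split[of 1 a i] that by force
qed

lemma mon_induct [case_names zero add]:
  fixes a :: "'n::finite \<Rightarrow>\<^sub>0 nat"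
  assumes "P 0" "\<And>i b. P b \<Longrightarrow> P (Poly_Mapping.single i 1 + b)"
  shows "P a"
proof (induction "mon_degree a" arbitrary: a)
  case 0
  then show ?case using assms(1) mon_degree_eq_0_iff[of a] by metis
next
  case (Suc d)
  then have "a \<noteq> 0" using mon_degree_eq_0_iff[of a] by (metis nat.distinct(1))
  then obtain i b where a: "a = Poly_Mapping.single i 1 + b" by (rule mon_nonzero_split)
  then have "P b" using Suc by (simp add: mon_degree_add)
  with a assms(2) show ?case by simp
qed

lemma single_eq_const_mult: "Poly_Mapping.single a c = const c * Poly_Mapping.single a 1"
  by (simp add: const_def mult_single)

lemma var_mult_single: "var i * Poly_Mapping.single a c = Poly_Mapping.single (Poly_Mapping.single i 1 + a) c"
  by (simp add: var_def mult_single)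

lemma var_power: "var i ^ k = Poly_Mapping.single (Poly_Mapping.single i k) 1"
proof (induction k)
  case (Suc k)
  then show ?case by (simp add: var_mult_single single_add[symmetric])
qed simp

lemma mem_ideal_monomials:
  fixes J :: "('n, 'k::field) mpoly set"
  assumes "is_ideal J" "\<And>a. a \<in> Poly_Mapping.keys f \<Longrightarrow> Poly_Mapping.single a 1 \<in> J"
  shows "f \<in> J"
proof -
  have "Poly_Mapping.single a (Poly_Mapping.lookup f a) \<in> J" if "a \<in> Poly_Mapping.keys f" for a
    by (subst single_eq_const_mult) (rule is_ideal_mult[OF assms(1) assms(2)[OF that]])
  then have "(\<Sum>a\<in>Poly_Mapping.keys f. Poly_Mapping.single a (Poly_Mapping.lookup f a)) \<in> J"
    by (rule is_ideal_sum[OF assms(1)])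
  then show ?thesis by (simp add: poly_mapping_sum_singles)
qed

lemma lookup_mult_zero:
  fixes f g :: "('n::finite, 'k::field) mpoly"
  shows "Poly_Mapping.lookup (f * g) 0 = Poly_Mapping.lookup f 0 * Poly_Mapping.lookup g 0"
proof -
  have *: "Poly_Mapping.lookup (Poly_Mapping.single a c * g) 0 =
      Poly_Mapping.lookup (Poly_Mapping.single a c) 0 * Poly_Mapping.lookup g 0" for a c
  proof -
    have "Poly_Mapping.lookup (Poly_Mapping.single a c * Poly_Mapping.single b e) 0 =
      Poly_Mapping.lookup (Poly_Mapping.single a c) 0 *
      Poly_Mapping.lookup (Poly_Mapping.single b e) 0" for b e
    proof -
      have "a + b = 0 \<longleftrightarrow> a = 0 \<and> b = 0"
        using mon_degree_eq_0_iff[of "a + b"] by (simp add: mon_degree_add)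
      then show ?thesis by (auto simp: mult_single lookup_single when_def)
    qed
    then have "Poly_Mapping.lookup (Poly_Mapping.single a c *
        (\<Sum>b\<in>Poly_Mapping.keys g. Poly_Mapping.single b (Poly_Mapping.lookup g b))) 0 =
      Poly_Mapping.lookup (Poly_Mapping.single a c) 0 *
      Poly_Mapping.lookup (\<Sum>b\<in>Poly_Mapping.keys g. Poly_Mapping.single b (Poly_Mapping.lookup g b)) 0"
      by (simp add: sum_distrib_left lookup_sum)
    then show ?thesis by (simp only: poly_mapping_sum_singles)
  qed
  then have "Poly_Mapping.lookup
      ((\<Sum>b\<in>Poly_Mapping.keys f. Poly_Mapping.single b (Poly_Mapping.lookup f b)) * g) 0 =
      Poly_Mapping.lookup (\<Sum>b\<in>Poly_Mapping.keys f. Poly_Mapping.single b (Poly_Mapping.lookup f b)) 0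
      * Poly_Mapping.lookup g 0"
    by (simp add: sum_distrib_right lookup_sum)
  then show ?thesis by (simp only: poly_mapping_sum_singles)
qed

lemma lookup_zero_homogeneous:
  "homogeneous d f \<Longrightarrow> 0 < d \<Longrightarrow> Poly_Mapping.lookup f 0 = 0"
  unfolding homogeneous_def by (metis in_keys_iff mon_degree_eq_0_iff less_irrefl)

definition hcomp :: "nat \<Rightarrow> ('n::finite, 'k::field) mpoly \<Rightarrow> ('n, 'k) mpoly" where
  "hcomp d f = (\<Sum>a\<in>{a\<in>Poly_Mapping.keys f. mon_degree a = d}.
     Poly_Mapping.single a (Poly_Mapping.lookup f a))"

lemma lookup_hcomp:
  "Poly_Mapping.lookup (hcomp d f) a = (if mon_degree a = d then Poly_Mapping.lookup f a else 0)"
  by (auto simp: hcomp_def lookup_sum lookup_single when_def in_keys_iff)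

lemma hcomp_add: "hcomp d (f + g) = hcomp d f + hcomp d g"
  and hcomp_zero [simp]: "hcomp d 0 = 0"
  by (rule poly_mapping_eqI, simp add: lookup_hcomp lookup_add)+

lemma hcomp_sum: "hcomp d (sum f A) = (\<Sum>x\<in>A. hcomp d (f x))"
  by (induction A rule: infinite_finite_induct) (simp_all add: hcomp_add)

lemma hcomp_homogeneous: "homogeneous e f \<Longrightarrow> hcomp d f = (if d = e then f else 0)"
  by (rule poly_mapping_eqI) (auto simp: lookup_hcomp homogeneous_def in_keys_iff)

lemma hcomp_0: "hcomp 0 f = const (Poly_Mapping.lookup f 0)"
  by (rule poly_mapping_eqI) (auto simp: lookup_hcomp const_def lookup_single when_def)

lemma hcomp_single:
  "hcomp d (Poly_Mapping.single a c) = (if mon_degree a = d then Poly_Mapping.single a c else 0)"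
  by (rule poly_mapping_eqI) (auto simp: lookup_hcomp lookup_single when_def)

lemma hcomp_single_mult:
  "hcomp d (Poly_Mapping.single b c * f) =
     (if mon_degree b \<le> d then Poly_Mapping.single b c * hcomp (d - mon_degree b) f else 0)"
proof -
  have "hcomp d (Poly_Mapping.single b c * Poly_Mapping.single a e) =
     (if mon_degree b \<le> d then Poly_Mapping.single b c *
        hcomp (d - mon_degree b) (Poly_Mapping.single a e) else 0)" for a e
    by (auto simp: mult_single hcomp_single mon_degree_add)
  then have "hcomp d (Poly_Mapping.single b c *
        (\<Sum>a\<in>Poly_Mapping.keys f. Poly_Mapping.single a (Poly_Mapping.lookup f a))) =
     (if mon_degree b \<le> d then Poly_Mapping.single b c *
        hcomp (d - mon_degree b)
          (\<Sum>a\<in>Poly_Mapping.keys f. Poly_Mapping.single a (Poly_Mapping.lookup f a)) else 0)"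
    by (simp add: sum_distrib_left hcomp_sum)
  then show ?thesis by (simp only: poly_mapping_sum_singles)
qed

lemma hcomp_mem_ideal_generated:
  assumes S: "\<And>f. f \<in> S \<Longrightarrow> \<exists>d. homogeneous d f" and f: "f \<in> ideal_generated S"
  shows "hcomp d f \<in> ideal_generated S"
proof -
  let ?J = "ideal_generated S"
  note J = is_ideal_generated[of S]
  have "?J \<subseteq> {f. \<forall>d. hcomp d f \<in> ?J}"
  proof (rule ideal_generated_minimal)
    show "S \<subseteq> {f. \<forall>d. hcomp d f \<in> ?J}"
    proof clarify
      fix f d assume "f \<in> S"
      then obtain e where "homogeneous e f" using S by blast
      moreover have "f \<in> ?J" using \<open>f \<in> S\<close> ideal_generated_superset by blast
      ultimately show "hcomp d f \<in> ?J" by (simp add: hcomp_homogeneous is_ideal_zero[OF J])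
    qed
    show "is_ideal {f. \<forall>d. hcomp d f \<in> ?J}"
    proof (rule is_idealI; clarsimp)
      show "0 \<in> ?J" by (rule is_ideal_zero[OF J])
      show "hcomp d (a + b) \<in> ?J" if "\<forall>d. hcomp d a \<in> ?J" "\<forall>d. hcomp d b \<in> ?J" for a b d
        using that by (simp add: hcomp_add is_ideal_add[OF J])
      show "hcomp d (r * a) \<in> ?J" if "\<forall>d. hcomp d a \<in> ?J" for r a d
      proof -
        have "hcomp d ((\<Sum>b\<in>Poly_Mapping.keys r.
            Poly_Mapping.single b (Poly_Mapping.lookup r b)) * a) \<in> ?J"
          using that unfolding sum_distrib_right hcomp_sum hcomp_single_mult
          by (intro is_ideal_sum[OF J]) (simp add: is_ideal_mult[OF J] is_ideal_zero[OF J])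
        then show ?thesis by (simp only: poly_mapping_sum_singles)
      qed
    qed
  qed
  with f show ?thesis by blast
qed


section \<open>The differentiation pairing\<close>

lemma lookup_partial_mon:
  fixes a :: "'n::finite \<Rightarrow>\<^sub>0 nat"
  shows "\<exists>m::'k::field_char_0. m \<noteq> 0 \<and> (\<forall>g. Poly_Mapping.lookup (partial_mon a g) c =
    m * Poly_Mapping.lookup g (c + a))"
proof (induction a arbitrary: c rule: mon_induct)
  case zero
  then show ?case by (intro exI[of _ 1]) simp
next
  case (add i b)
  obtain m :: 'k where "m \<noteq> 0" "\<And>g. Poly_Mapping.lookup (partial_mon b g) (c + Poly_Mapping.single i 1)
      = m * Poly_Mapping.lookup g (c + Poly_Mapping.single i 1 + b)"
    using add by blast
  then show ?case
    by (intro exI[of _ "of_nat (Suc (Poly_Mapping.lookup c i)) * m"])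
       (simp add: partial_mon_plus lookup_partial add.assoc partial_mon_single[simplified]
          del: of_nat_Suc)
qed

lemma act_monomial: "act (Poly_Mapping.single a 1) g = partial_mon a g"
  by (simp add: act_single)

lemma monomial_pairing_eq_0:
  fixes g :: "('n::finite, 'k::field_char_0) mpoly"
  shows "Poly_Mapping.lookup (act (Poly_Mapping.single a 1) g) 0 = 0 \<longleftrightarrow> Poly_Mapping.lookup g a = 0"
  using lookup_partial_mon[where a = a and c = 0 and 'k='k] by (auto simp: act_monomial)

lemma pairing_nondegenerate:
  fixes g :: "('n::finite, 'k::field_char_0) mpoly"
  assumes "\<And>a. Poly_Mapping.lookup (act (Poly_Mapping.single a 1) g) 0 = 0"
  shows "g = 0"
  using assms by (intro poly_mapping_eqI) (simp add: monomial_pairing_eq_0)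

lemma act_const_mult_right: "act f (const c * g) = const c * act f g"
  by (simp add: act_def partial_mon_const_mult sum_distrib_left mult.left_commute)

lemma act_const [simp]: "act (const c) g = const c * g"
  using act_single[of 0 c g] by (simp flip: const_def)

lemma act_commute: "act f (act g h) = act g (act f h)"
  by (metis act_mult mult.commute)

lemma act_power_eq_0:
  fixes g :: "('n::finite, 'k::field_char_0) mpoly"
  assumes "Poly_Mapping.lookup z 0 = 0"
  obtains l where "act (z ^ l) g = 0"
proof -
  have "act (z ^ d) g = 0" if "\<And>b. d \<le> mon_degree b \<Longrightarrow> Poly_Mapping.lookup g b = 0" for d
    using that
  proof (induction d arbitrary: g)
    case 0
    then have "g = 0" by (intro poly_mapping_eqI) simp
    then show ?case by simp
  next
    case (Suc d)
    have "Poly_Mapping.lookup (act z g) b = 0" if b: "d \<le> mon_degree b" for b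
    proof -
      have "Poly_Mapping.lookup (partial_mon a g) b = 0" if "a \<in> Poly_Mapping.keys z" for a
      proof -
        have "a \<noteq> 0" using that assms by (auto simp: in_keys_iff)
        then have "0 < mon_degree a" using mon_degree_eq_0_iff by blast
        then have "Suc d \<le> mon_degree (b + a)" using b by (simp add: mon_degree_add)
        then show ?thesis using Suc.prems lookup_partial_mon[where a = a and c = b and 'k='k] by auto
      qed
      then show ?thesis by (simp add: act_def lookup_sum)
    qed
    then have "act (z ^ d) (act z g) = 0" by (rule Suc.IH)
    then show ?case by (simp add: act_mult[symmetric] mult.commute)
  qed
  moreover have "Poly_Mapping.lookup g b = 0"
    if b: "Suc (\<Sum>a\<in>Poly_Mapping.keys g. mon_degree a) \<le> mon_degree b" for b
  proof (rule ccontr)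
    assume "Poly_Mapping.lookup g b \<noteq> 0"
    then have "mon_degree b \<le> (\<Sum>a\<in>Poly_Mapping.keys g. mon_degree a)"
      by (intro member_le_sum) (auto simp: in_keys_iff)
    with b show False by simp
  qed
  ultimately show ?thesis using that by blast
qed

lemma total_degree_attained:
  assumes "total_degree g = ereal (real s)"
  obtains a where "a \<in> Poly_Mapping.keys g" "mon_degree a = s"
proof -
  let ?D = "(\<lambda>a. ereal (real (mon_degree a))) ` Poly_Mapping.keys g"
  have "?D \<noteq> {}" using assms by (auto simp: total_degree_def bot_ereal_def)
  then have "Sup ?D \<in> ?D" by (simp add: Max_Sup[symmetric])
  with assms that show ?thesis by (auto simp: total_degree_def)
qed

lemma submodule_generated_singleton: "submodule_generated {g} = range (\<lambda>a. act a g)"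
  unfolding submodule_generated_def by (rule module.span_singleton[OF module_act])

lemma submodule_generated_superset: "W \<subseteq> submodule_generated W"
  unfolding submodule_generated_def by (rule module.span_superset[OF module_act])

lemma subspace_inverse_system: "module.subspace act (inverse_system I)"
  unfolding module.subspace_def[OF module_act]
  by (auto simp: inverse_system_def act_add_right) (subst act_commute, simp)

lemma submodule_generated_subset_inverse_system:
  "W \<subseteq> inverse_system I \<Longrightarrow> submodule_generated W \<subseteq> inverse_system I"
  unfolding submodule_generated_def
  by (rule module.span_minimal[OF module_act _ subspace_inverse_system])

lemma act_mem_submodule_generated:
  "g \<in> submodule_generated W \<Longrightarrow> act a g \<in> submodule_generated W"
  unfolding submodule_generated_def by (rule module.span_scale[OF module_act])

lemma is_ideal_annihilator: "is_ideal (annihilator W)"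
  by (rule is_idealI) (auto simp: annihilator_def act_add_left act_mult)

lemma mem_inverse_system_insert:
  assumes "is_ideal I"
  shows "g \<in> inverse_system (ideal_generated (I \<union> {z})) \<longleftrightarrow> g \<in> inverse_system I \<and> act z g = 0"
proof -
  have "ideal_generated (I \<union> {z}) \<subseteq> annihilator {g} \<longleftrightarrow> I \<union> {z} \<subseteq> annihilator {g}"
    using ideal_generated_minimal[OF _ is_ideal_annihilator, of "I \<union> {z}" "{g}"]
      ideal_generated_superset[of "I \<union> {z}"] by (intro iffI) (rule subset_trans)
  then show ?thesis by (auto simp: inverse_system_def annihilator_def)
qed

lemma functional_in_span:
  fixes \<phi> :: "'i \<Rightarrow> ('n::finite, 'k::field) mpoly \<Rightarrow> 'k" and \<psi> :: "('n, 'k) mpoly \<Rightarrow> 'k"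
  assumes "finite S"
    and "\<And>i f g. i \<in> S \<Longrightarrow> \<phi> i (f + g) = \<phi> i f + \<phi> i g"
    and "\<And>i c f. i \<in> S \<Longrightarrow> \<phi> i (const c * f) = c * \<phi> i f"
    and "\<And>f g. \<psi> (f + g) = \<psi> f + \<psi> g" and "\<And>c f. \<psi> (const c * f) = c * \<psi> f"
    and "\<And>f. (\<And>i. i \<in> S \<Longrightarrow> \<phi> i f = 0) \<Longrightarrow> \<psi> f = 0"
  shows "\<exists>u. \<forall>f. \<psi> f = (\<Sum>i\<in>S. u i * \<phi> i f)"
  using assms
proof (induction S arbitrary: \<psi>)
  case empty
  then show ?case by simp
next
  case (insert j S)
  show ?case
  proof (cases "\<exists>v. (\<forall>i\<in>S. \<phi> i v = 0) \<and> \<phi> j v \<noteq> 0")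
    case False
    then have "\<exists>u. \<forall>f. \<psi> f = (\<Sum>i\<in>S. u i * \<phi> i f)"
    proof (intro insert.IH insert.prems(1,2))
      show "\<psi> f = 0" if "\<And>i. i \<in> S \<Longrightarrow> \<phi> i f = 0" for f
        using that False by (intro insert.prems(5)) auto
    qed (auto intro: insert.prems)
    then obtain u where u: "\<And>f. \<psi> f = (\<Sum>i\<in>S. u i * \<phi> i f)" by blast
    have "\<psi> f = (\<Sum>i\<in>insert j S. (u(j := 0)) i * \<phi> i f)" for f
      using insert.hyps by (simp add: u) (rule sum.cong, auto)
    then show ?thesis by blast
  next
    case True
    then obtain v where v: "\<And>i. i \<in> S \<Longrightarrow> \<phi> i v = 0" "\<phi> j v \<noteq> 0" by blast
    define q where "q = \<psi> v / \<phi> j v"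
    have "\<exists>u. \<forall>f. \<psi> f - q * \<phi> j f = (\<Sum>i\<in>S. u i * \<phi> i f)"
    proof (rule insert.IH)
      fix f assume f: "\<And>i. i \<in> S \<Longrightarrow> \<phi> i f = 0"
      define c where "c = - \<phi> j f / \<phi> j v"
      have "\<phi> i (f + const c * v) = 0" if "i \<in> insert j S" for i
        using that v f insert.prems(1,2) by (auto simp: c_def)
      then have "\<psi> (f + const c * v) = 0" by (rule insert.prems(5))
      then have "\<psi> f + c * \<psi> v = 0" by (simp only: insert.prems(3,4))
      then show "\<psi> f - q * \<phi> j f = 0" by (simp add: c_def q_def)
    qed (simp_all add: insert.prems right_diff_distrib distrib_left mult.left_commute)
    then obtain u where u: "\<And>f. \<psi> f - q * \<phi> j f = (\<Sum>i\<in>S. u i * \<phi> i f)" by blast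
    have "\<psi> f = (\<Sum>i\<in>insert j S. (u(j := q)) i * \<phi> i f)" for f
    proof -
      have "(\<Sum>i\<in>S. (u(j := q)) i * \<phi> i f) = (\<Sum>i\<in>S. u i * \<phi> i f)"
        using insert.hyps by (intro sum.cong) auto
      then show ?thesis using insert.hyps u[of f] by (simp add: algebra_simps)
    qed
    then show ?thesis by blast
  qed
qed


section \<open>Regular elements and socles\<close>

lemma socle_mult:
  assumes J: "is_ideal J" and f: "f \<in> socle J" and t: "Poly_Mapping.lookup t 0 = 0"
  shows "t * f \<in> J"
proof -
  have "t \<in> {t. t * f \<in> J}"
  proof (rule mem_ideal_monomials)
    show "is_ideal {t. t * f \<in> J}"
      by (rule is_idealI)
         (auto simp: is_ideal_zero[OF J] is_ideal_add[OF J] is_ideal_mult[OF J] distrib_right mult.assoc)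
    fix a assume "a \<in> Poly_Mapping.keys t"
    then have "a \<noteq> 0" using t by (auto simp: in_keys_iff)
    then obtain i b where "a = Poly_Mapping.single i 1 + b" by (rule mon_nonzero_split)
    then have "Poly_Mapping.single a 1 * f = Poly_Mapping.single b 1 * (var i * f)"
      by (simp add: var_mult_single[symmetric] mult_ac del: One_nat_def)
    moreover have "var i * f \<in> J" using f by (simp add: socle_def)
    ultimately show "Poly_Mapping.single a 1 \<in> {t. t * f \<in> J}" by (simp add: is_ideal_mult[OF J])
  qed
  then show ?thesis by simp
qed

text \<open>
  The map \<open>s \<mapsto> z s / x\<close> identifies the socle modulo \<open>(I, x)\<close> with the socle modulo \<open>(I, z)\<close>;
  this replaces the usual comparison through \<open>Ext\<close>.
\<close>

lemma socle_shift:
  fixes x z :: "('n::finite, 'k::field) mpoly"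
  assumes I: "is_ideal I" and x: "quotient_nonzerodivisor I x" and z0: "Poly_Mapping.lookup z 0 = 0"
    and s: "s \<in> socle (ideal_generated (I \<union> {x}))"
  obtains g where "z * s - x * g \<in> I" "g \<in> socle (ideal_generated (I \<union> {z}))"
proof -
  note mem = mem_ideal_generated_insert[OF I]
  have "z * s \<in> ideal_generated (I \<union> {x})"
    by (rule socle_mult[OF is_ideal_generated s z0])
  then obtain g where g: "z * s - x * g \<in> I" using mem by blast
  have "var i * g \<in> ideal_generated (I \<union> {z})" for i
  proof -
    have "var i * s \<in> ideal_generated (I \<union> {x})" using s by (simp add: socle_def)
    then obtain h where h: "var i * s - x * h \<in> I" using mem by blast
    have "x * (var i * g - z * h) = z * (var i * s - x * h) - var i * (z * s - x * g)"
      by (simp add: algebra_simps)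
    also have "\<dots> \<in> I"
      by (rule is_ideal_diff[OF I is_ideal_mult[OF I h] is_ideal_mult[OF I g]])
    finally show ?thesis using x mem unfolding quotient_nonzerodivisor_def by blast
  qed
  with g that show ?thesis by (simp add: socle_def)
qed

lemma socle_one_dimensional_change:
  fixes x z :: "('n::finite, 'k::field) mpoly"
  assumes I: "is_ideal I" and x: "quotient_nonzerodivisor I x" and z: "quotient_nonzerodivisor I z"
    and x0: "Poly_Mapping.lookup x 0 = 0" and z0: "Poly_Mapping.lookup z 0 = 0"
    and soc: "socle_one_dimensional (ideal_generated (I \<union> {x}))"
  shows "socle_one_dimensional (ideal_generated (I \<union> {z}))"
proof -
  note mem = mem_ideal_generated_insert[OF I]
  have cancel: "f \<in> I" if "x * f \<in> I \<or> z * f \<in> I" for f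
    using that x z unfolding quotient_nonzerodivisor_def by blast
  obtain s where s: "s \<in> socle (ideal_generated (I \<union> {x}))" "s \<notin> ideal_generated (I \<union> {x})"
    and span: "\<And>f. f \<in> socle (ideal_generated (I \<union> {x})) \<Longrightarrow>
      \<exists>c. f - const c * s \<in> ideal_generated (I \<union> {x})"
    using soc unfolding socle_one_dimensional_def by blast
  obtain g where g: "z * s - x * g \<in> I" "g \<in> socle (ideal_generated (I \<union> {z}))"
    using socle_shift[OF I x z0 s(1)] .
  have "g \<notin> ideal_generated (I \<union> {z})"
  proof
    assume "g \<in> ideal_generated (I \<union> {z})"
    then obtain h where h: "g - z * h \<in> I" using mem by blast
    have "z * (s - x * h) = (z * s - x * g) + x * (g - z * h)" by (simp add: algebra_simps)
    also have "\<dots> \<in> I" using g h by (intro is_ideal_add is_ideal_mult I)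
    finally have "s - x * h \<in> I" using cancel by blast
    with s(2) mem show False by blast
  qed
  moreover have "\<exists>c. f - const c * g \<in> ideal_generated (I \<union> {z})"
    if f: "f \<in> socle (ideal_generated (I \<union> {z}))" for f
  proof -
    obtain f' where f': "x * f - z * f' \<in> I" "f' \<in> socle (ideal_generated (I \<union> {x}))"
      using socle_shift[OF I z x0 f] .
    then obtain c h where h: "f' - const c * s - x * h \<in> I" using span mem by blast
    have "x * (f - const c * g - z * h) =
        (x * f - z * f') + z * (f' - const c * s - x * h) + const c * (z * s - x * g)"
      by (simp add: algebra_simps)
    also have "\<dots> \<in> I" using f' h g by (intro is_ideal_add is_ideal_mult I)
    finally have "f - const c * g - z * h \<in> I" using cancel by blast
    then show ?thesis using mem by blast
  qed
  ultimately show ?thesis using g(2) unfolding socle_one_dimensional_def by blast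
qed


section \<open>The artinian reduction\<close>

lemma prime_ideal_irrelevant: "prime_ideal {f :: ('n::finite, 'k::field) mpoly. Poly_Mapping.lookup f 0 = 0}"
proof -
  have "1 \<notin> {f :: ('n, 'k) mpoly. Poly_Mapping.lookup f 0 = 0}"
    by (simp add: lookup_one)
  then have "{f :: ('n, 'k) mpoly. Poly_Mapping.lookup f 0 = 0} \<noteq> UNIV" by blast
  then show ?thesis
    unfolding prime_ideal_def by (auto intro!: is_idealI simp: lookup_mult_zero lookup_add)
qed

text \<open>
  If no power of \<open>x\<^sub>i\<close> lay in \<open>J = (I, z)\<close>, there would be a chain \<open>Q \<subset> P \<subset> m\<close> of primes with
  \<open>J \<subseteq> P\<close> and \<open>z \<notin> Q\<close>. Taking \<open>P\<close> disjoint from the elements \<open>x\<^sub>i\<^sup>k u\<close> with \<open>u \<notin> m\<close> forces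
  \<open>P \<subset> m\<close> without any discussion of homogeneous primes.
\<close>

lemma var_power_mem:
  fixes z :: "('n::finite, 'k::field) mpoly"
  assumes I: "homogeneous_ideal I" and z: "homogeneous 1 z" "quotient_nonzerodivisor I z"
    and dim: "quotient_dim I = 1"
  shows "\<exists>k. var i ^ k \<in> ideal_generated (I \<union> {z})"
proof (rule ccontr)
  let ?J = "ideal_generated (I \<union> {z})"
  let ?m = "{f :: ('n, 'k) mpoly. Poly_Mapping.lookup f 0 = 0}"
  assume neg: "\<nexists>k. var i ^ k \<in> ?J"
  note J = is_ideal_generated[of "I \<union> {z}"]
  obtain S where S: "\<And>f. f \<in> S \<Longrightarrow> \<exists>d. homogeneous d f" "I = ideal_generated S"
    using I unfolding homogeneous_ideal_def by blast
  have idI: "is_ideal I" by (simp add: S(2) is_ideal_generated)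
  have "I \<union> {z} \<subseteq> ideal_generated (S \<union> {z})"
    using ideal_generated_minimal[OF _ is_ideal_generated, of S "S \<union> {z}"]
      ideal_generated_superset[of "S \<union> {z}"] S(2) by blast
  moreover have "S \<union> {z} \<subseteq> ?J"
    using ideal_generated_superset[of "I \<union> {z}"] ideal_generated_superset[of S] S(2) by blast
  ultimately have JS: "?J = ideal_generated (S \<union> {z})"
    by (intro subset_antisym ideal_generated_minimal is_ideal_generated)
  have comp: "hcomp d f \<in> ?J" if "f \<in> ?J" for d f
    using that S(1) z(1) unfolding JS by (intro hcomp_mem_ideal_generated) auto
  let ?U = "{var i ^ k * u | k u. u \<notin> ?m}"
  have U_disj: "?J \<inter> ?U = {}"
  proof (rule ccontr)
    assume "?J \<inter> ?U \<noteq> {}"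
    then obtain k u where u: "var i ^ k * u \<in> ?J" "u \<notin> ?m" by blast
    from comp[OF u(1), of k] have "var i ^ k * const (Poly_Mapping.lookup u 0) \<in> ?J"
      by (simp add: var_power hcomp_single_mult hcomp_0)
    then have "const (1 / Poly_Mapping.lookup u 0) * (var i ^ k * const (Poly_Mapping.lookup u 0)) \<in> ?J"
      by (rule is_ideal_mult[OF J])
    moreover have "const (1 / Poly_Mapping.lookup u 0) * const (Poly_Mapping.lookup u 0)
        = (1 :: ('n, 'k) mpoly)"
      using u(2) by (simp flip: const_mult)
    ultimately have "var i ^ k \<in> ?J" by (simp add: mult.left_commute)
    with neg show False by blast
  qed
  have U_one: "1 \<in> ?U" by (rule CollectI, rule exI[of _ 0], rule exI[of _ 1]) (simp add: lookup_one)
  have U_mult: "a * b \<in> ?U" if ab: "a \<in> ?U" "b \<in> ?U" for a b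
  proof -
    obtain k u l v where "a = var i ^ k * u" "b = var i ^ l * v" "u \<notin> ?m" "v \<notin> ?m" using ab by blast
    then have "a * b = var i ^ (k + l) * (u * v)" "u * v \<notin> ?m"
      by (simp_all add: power_add mult_ac lookup_mult_zero)
    then show ?thesis by blast
  qed
  obtain P where P: "prime_ideal P" "?J \<subseteq> P" "P \<inter> ?U = {}"
    using prime_ideal_disjoint_exists[OF J U_one U_mult U_disj] .
  have inU: "u \<in> ?U" if "u \<notin> ?m" for u
    by (rule CollectI, rule exI[of _ 0], rule exI[of _ u]) (use that in simp)
  have "var i \<in> ?U"
    by (rule CollectI, rule exI[of _ 1], rule exI[of _ 1]) (simp add: lookup_one)
  then have "var i \<notin> P" using P(3) by blast
  moreover have "var i \<in> ?m"
    using mon_degree_eq_0_iff[of "Poly_Mapping.single i 1"] unfolding mon_degree_single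
    by (simp add: var_def lookup_single when_def)
  ultimately have Pm: "P \<subset> ?m" using P(3) inU by blast
  let ?T = "{z ^ k * b | k b. b \<notin> P}"
  have pow: "b \<in> I" if "z ^ k * b \<in> I" for k b
    using that z(2) by (induction k) (auto simp: quotient_nonzerodivisor_def mult.assoc)
  have IP: "I \<subseteq> P" "z \<in> P" using P(2) ideal_generated_superset[of "I \<union> {z}"] by blast+
  then have T_disj: "I \<inter> ?T = {}" using pow by blast
  have one: "1 \<notin> P"
    using P(1) is_ideal_mult[of P 1] unfolding prime_ideal_def by (metis UNIV_eq_I mult.right_neutral)
  then have T_one: "1 \<in> ?T" by (intro CollectI exI[of _ 0] exI[of _ 1]) simp
  have T_mult: "a * b \<in> ?T" if ab: "a \<in> ?T" "b \<in> ?T" for a b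
  proof -
    obtain k u l v where *: "a = z ^ k * u" "b = z ^ l * v" "u \<notin> P" "v \<notin> P" using ab by blast
    then have "a * b = z ^ (k + l) * (u * v)" by (simp add: power_add mult_ac)
    moreover have "u * v \<notin> P" using * P(1) unfolding prime_ideal_def by blast
    ultimately show ?thesis by blast
  qed
  obtain Q where Q: "prime_ideal Q" "I \<subseteq> Q" "Q \<inter> ?T = {}"
    using prime_ideal_disjoint_exists[OF idI T_one T_mult T_disj] .
  have "b \<in> ?T" if "b \<notin> P" for b
    by (rule CollectI, rule exI[of _ 0], rule exI[of _ b]) (use that in simp)
  moreover have "z \<in> ?T"
    by (rule CollectI, rule exI[of _ 1], rule exI[of _ 1]) (use one in simp)
  ultimately have "Q \<subset> P" using Q(3) IP(2) by blast
  from quotient_dim_chain[OF Q(1) P(1) prime_ideal_irrelevant Q(2) this Pm] dim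
  show False by (simp add: one_enat_def numeral_eq_enat)
qed

lemma monomials_mem_eventually:
  fixes J :: "('n::finite, 'k::field) mpoly set"
  assumes J: "is_ideal J" and pow: "\<And>i. \<exists>k. var i ^ k \<in> J"
  obtains N where "\<And>a. N \<le> mon_degree a \<Longrightarrow> Poly_Mapping.single a 1 \<in> J"
proof -
  obtain k where k: "\<And>i. var i ^ k i \<in> J" using pow by metis
  have "Poly_Mapping.single a 1 \<in> J" if a: "Suc (sum k UNIV) \<le> mon_degree a" for a
  proof -
    have "\<not> (\<forall>i. Poly_Mapping.lookup a i \<le> k i)"
      using a sum_mono[of UNIV "Poly_Mapping.lookup a" k] by (auto simp: mon_degree_def)
    then obtain i where "k i \<le> Poly_Mapping.lookup a i" by (meson linear)
    then obtain b where "a = Poly_Mapping.single i (k i) + b" by (rule mon_split)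
    then have "Poly_Mapping.single a 1 = Poly_Mapping.single b (1::'k) * var i ^ k i"
      by (simp add: var_power mult_single add.commute)
    then show ?thesis using is_ideal_mult[OF J k] by simp
  qed
  with that show ?thesis by blast
qed


section \<open>Generating the inverse system\<close>

text \<open>
  An ideal strictly containing \<open>J\<close> contains the socle of \<open>J\<close>, which is spanned modulo \<open>J\<close> by
  the forms of top degree; these cannot all kill the top degree part of \<open>G\<close>.
\<close>

lemma annihilator_eq:
  fixes J :: "('n::finite, 'k::field_char_0) mpoly set"
  assumes J: "is_ideal J" and N: "\<And>a. N \<le> mon_degree a \<Longrightarrow> Poly_Mapping.single a 1 \<in> J"
    and soc: "socle_one_dimensional J"
    and top: "\<And>a. s < mon_degree a \<Longrightarrow> Poly_Mapping.single a 1 \<in> J"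
    and G: "G \<in> inverse_system J" and a: "a \<in> Poly_Mapping.keys G" "mon_degree a = s"
    and f: "act f G = 0"
  shows "f \<in> J"
proof (rule ccontr)
  assume fJ: "f \<notin> J"
  let ?P = "\<lambda>d. \<exists>b. mon_degree b = d \<and> Poly_Mapping.single b 1 * f \<notin> J"
  have P0: "?P 0" using fJ by (intro exI[of _ 0]) simp
  have bound: "d \<le> N" if "?P d" for d
    using that N is_ideal_mult[OF J, of _ f] by (metis mult.commute nle_le)
  define d where "d = (GREATEST d. ?P d)"
  have "?P d" unfolding d_def using P0 bound by (rule GreatestI_nat)
  then obtain b where b: "mon_degree b = d" "Poly_Mapping.single b 1 * f \<notin> J" by blast
  define g where "g = Poly_Mapping.single b 1 * f"
  have "var i * g \<in> J" for i
  proof (rule ccontr)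
    assume "var i * g \<notin> J"
    then have "?P (Suc d)"
      using b by (intro exI[of _ "Poly_Mapping.single i 1 + b"])
        (simp add: g_def mon_degree_add var_mult_single mult.assoc[symmetric])
    then have "Suc d \<le> d" unfolding d_def using bound by (rule Greatest_le_nat)
    then show False by simp
  qed
  then have "g \<in> socle J" by (simp add: socle_def)
  have "g \<notin> J" using b by (simp add: g_def)
  have gG: "act g G = 0" using f by (simp add: g_def act_mult)
  obtain w where w: "w \<in> socle J" "w \<notin> J" "\<And>h. h \<in> socle J \<Longrightarrow> \<exists>c. h - const c * w \<in> J"
    using soc unfolding socle_one_dimensional_def by blast
  have kill: "act h G = const c * act w G" if "h - const c * w \<in> J" for h c
  proof -
    have "act (h - const c * w) G = 0" using that G by (simp add: inverse_system_def)
    moreover have "act h G = act (h - const c * w) G + act (const c * w) G"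
      by (simp flip: act_add_left)
    ultimately show ?thesis by (simp add: act_mult)
  qed
  obtain c where c: "g - const c * w \<in> J" using w(3) \<open>g \<in> socle J\<close> by blast
  have "c \<noteq> 0" using c \<open>g \<notin> J\<close> by auto
  have "act w G = const (1 / c) * (const c * act w G)"
    using \<open>c \<noteq> 0\<close> by (simp add: mult.assoc[symmetric] const_mult[symmetric])
  then have wG: "act w G = 0" using kill[OF c] gG by simp
  have "Poly_Mapping.single a 1 \<in> socle J"
    using a(2) by (auto simp: socle_def var_mult_single mon_degree_add intro!: top)
  then have "act (Poly_Mapping.single a 1) G = 0" using w(3) kill wG by fastforce
  then have "Poly_Mapping.lookup G a = 0" using monomial_pairing_eq_0[of a G] by simp
  with a show False by (simp add: in_keys_iff)
qed

text \<open>
  The functional \<open>f \<mapsto> (f \<circ> H)(0)\<close> vanishes on the common kernel \<open>J\<close> of the finitely many functionals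
  \<open>f \<mapsto> (f \<circ> (x\<^sup>a \<circ> G))(0)\<close>, hence is a combination of them.
\<close>

lemma inverse_system_cyclic:
  fixes J :: "('n::finite, 'k::field_char_0) mpoly set"
  assumes N: "\<And>a. N \<le> mon_degree a \<Longrightarrow> Poly_Mapping.single a 1 \<in> J"
    and G: "G \<in> inverse_system J" and ann: "\<And>f. act f G = 0 \<Longrightarrow> f \<in> J"
    and H: "H \<in> inverse_system J"
  obtains u where "H = act u G"
proof -
  let ?S = "{a :: 'n \<Rightarrow>\<^sub>0 nat. mon_degree a < N}"
  let ?\<phi> = "\<lambda>a f. Poly_Mapping.lookup (act f (act (Poly_Mapping.single a 1) G)) 0"
  have "Poly_Mapping.lookup ` ?S \<subseteq> {h. \<forall>i. (i \<in> UNIV \<longrightarrow> h i \<in> {..N}) \<and> (i \<notin> UNIV \<longrightarrow> h i = 0)}"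
  proof clarsimp
    fix a :: "'n \<Rightarrow>\<^sub>0 nat" and i assume "mon_degree a < N"
    moreover have "Poly_Mapping.lookup a i \<le> mon_degree a"
      unfolding mon_degree_def by (rule member_le_sum) auto
    ultimately show "Poly_Mapping.lookup a i \<le> N" by simp
  qed
  then have "finite (Poly_Mapping.lookup ` ?S)"
    by (rule finite_subset) (rule finite_set_of_finite_funs, auto)
  then have "finite ?S" by (rule finite_imageD) (simp add: inj_on_def poly_mapping.lookup_inject)
  moreover have "Poly_Mapping.lookup (act f H) 0 = 0" if f: "\<And>a. a \<in> ?S \<Longrightarrow> ?\<phi> a f = 0" for f
  proof -
    have "Poly_Mapping.lookup (act (Poly_Mapping.single a 1) (act f G)) 0 = 0" for a
    proof (cases "mon_degree a < N")
      case True
      then show ?thesis using f[of a] by (simp add: act_commute[of f])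
    next
      case False
      then have "act (Poly_Mapping.single a 1) G = 0" using N G by (simp add: inverse_system_def)
      then show ?thesis by (simp add: act_commute[of _ f])
    qed
    then have "f \<in> J" by (intro ann pairing_nondegenerate)
    then show ?thesis using H by (simp add: inverse_system_def)
  qed
  ultimately have "\<exists>u. \<forall>f. Poly_Mapping.lookup (act f H) 0 = (\<Sum>a\<in>?S. u a * ?\<phi> a f)"
    by (intro functional_in_span) (auto simp: act_add_left lookup_add act_mult)
  then obtain u where u: "\<And>f. Poly_Mapping.lookup (act f H) 0 = (\<Sum>a\<in>?S. u a * ?\<phi> a f)" by blast
  let ?u = "\<Sum>a\<in>?S. Poly_Mapping.single a (u a)"
  have uG: "act ?u G = (\<Sum>a\<in>?S. const (u a) * act (Poly_Mapping.single a 1) G)"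
    by (simp add: act_sum_left act_single)
  have "Poly_Mapping.lookup (act f (act ?u G)) 0 = Poly_Mapping.lookup (act f H) 0" for f
    by (simp add: u uG act_sum_right act_const_mult_right lookup_sum)
  then have "Poly_Mapping.lookup (act f (H - act ?u G)) 0 = 0" for f
    using arg_cong[OF act_add_right[of f "H - act ?u G" "act ?u G"], of "\<lambda>p. Poly_Mapping.lookup p 0"]
    by (simp add: lookup_add)
  then have "H - act ?u G = 0" by (intro pairing_nondegenerate)
  with that show ?thesis by simp
qed

lemma reduction_inverse_system:
  fixes I :: "('n::finite, 'k::field_char_0) mpoly set"
  assumes gor: "gorenstein_graded I" and dim: "quotient_dim I = 1"
    and z: "homogeneous 1 z" "quotient_nonzerodivisor I z"
    and G: "G \<in> inverse_system I" "act z G = 0"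
    and deg: "total_degree G = ereal (real (socle_degree I z))"
    and H: "H \<in> inverse_system I" "act z H = 0"
  obtains u where "H = act u G"
proof -
  let ?J = "ideal_generated (I \<union> {z})"
  note J = is_ideal_generated[of "I \<union> {z}"]
  obtain \<theta> where hom: "homogeneous_ideal I" and \<theta>: "\<And>t. t \<in> set \<theta> \<Longrightarrow> \<exists>d>0. homogeneous d t"
      "quotient_regular_sequence I \<theta>" "enat (length \<theta>) = quotient_dim I"
      "socle_one_dimensional (ideal_generated (I \<union> set \<theta>))"
    using gor unfolding gorenstein_graded_def by blast
  have I: "is_ideal I"
    using hom is_ideal_generated unfolding homogeneous_ideal_def by blast
  have "length \<theta> = 1" using \<theta>(3) dim by (simp add: one_enat_def)
  then obtain x where x: "\<theta> = [x]" by (cases \<theta>) auto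
  have x0: "Poly_Mapping.lookup x 0 = 0" using \<theta>(1) x lookup_zero_homogeneous by auto
  have z0: "Poly_Mapping.lookup z 0 = 0" using z(1) lookup_zero_homogeneous by auto
  have xnzd: "quotient_nonzerodivisor I x"
    using \<theta>(2) by (simp add: x quotient_regular_sequence_def ideal_generated_ideal[OF I])
  have soc: "socle_one_dimensional ?J"
    using \<theta>(4) socle_one_dimensional_change[OF I xnzd z(2) x0 z0] by (simp add: x)
  obtain N where N: "\<And>a. N \<le> mon_degree a \<Longrightarrow> Poly_Mapping.single a 1 \<in> ?J"
    using monomials_mem_eventually[OF J var_power_mem[OF hom z dim]] by blast
  have bound: "t \<le> N" if ex: "\<exists>f. homogeneous t f \<and> f \<notin> ?J" for t
  proof (rule ccontr)
    assume "\<not> t \<le> N"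
    obtain f where f: "homogeneous t f" "f \<notin> ?J" using ex by blast
    have "f \<in> ?J"
    proof (rule mem_ideal_monomials[OF J], rule N)
      show "N \<le> mon_degree a" if "a \<in> Poly_Mapping.keys f" for a
        using f(1) that \<open>\<not> t \<le> N\<close> by (simp add: homogeneous_def)
    qed
    with f show False by simp
  qed
  have top: "Poly_Mapping.single a 1 \<in> ?J" if "socle_degree I z < mon_degree a" for a
  proof (rule ccontr)
    assume "Poly_Mapping.single a 1 \<notin> ?J"
    then have "\<exists>f. homogeneous (mon_degree a) f \<and> f \<notin> ?J"
      by (intro exI[of _ "Poly_Mapping.single a 1"]) (simp add: homogeneous_def)
    then have "mon_degree a \<le> socle_degree I z"
      unfolding socle_degree_def using bound by (rule Greatest_le_nat)
    with that show False by simp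
  qed
  have G': "G \<in> inverse_system ?J" and H': "H \<in> inverse_system ?J"
    using G H by (simp_all only: mem_inverse_system_insert[OF I] simp_thms)
  obtain a where a: "a \<in> Poly_Mapping.keys G" "mon_degree a = socle_degree I z"
    using total_degree_attained[OF deg] .
  show ?thesis
    using inverse_system_cyclic[OF N G' _ H'] annihilator_eq[OF J N soc top G' a] that by blast
qed

theorem proposition2p3:
  fixes I :: "('n::finite, 'k::{alg_closed_field, field_char_0}) mpoly set"
    and z :: "('n, 'k) mpoly"
    and F :: "nat \<Rightarrow> ('n, 'k) mpoly"
  assumes "gorenstein_graded I"
    and "quotient_dim I = 1"
    and "\<forall>l\<ge>1. F l \<in> inverse_system I"
    and "linear_form z"
    and "quotient_nonzerodivisor I z"
    and "\<forall>l>1. act z (F l) = F (l - 1)"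
    and "act z (F 1) = 0"
    and "total_degree (F 1) = ereal (real (socle_degree I z))"
  shows "(\<exists>\<alpha> :: nat \<Rightarrow> 'k. (\<forall>l\<ge>1. \<alpha> l \<noteq> 0) \<and>
            G_admissible z (\<lambda>l. const (1 / \<alpha> l) * F l) \<and>
            submodule_generated {const (1 / \<alpha> l) * F l | l. l \<ge> 1} = inverse_system I) \<and>
         submodule_generated {F l | l. l \<ge> 1} = inverse_system I"
proof -
  have F: "F l \<in> inverse_system I" if "l \<ge> 1" for l using assms(3) that by blast
  have inv: "act f G \<in> inverse_system I" "G - G' \<in> inverse_system I"
    if "G \<in> inverse_system I" "G' \<in> inverse_system I" for f G G'
    using that subspace_inverse_system[of I]
    by (simp_all add: module.subspace_scale[OF module_act] module.subspace_diff[OF module_act])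
  have base: "H \<in> submodule_generated {F 1}" if "H \<in> inverse_system I" "act z H = 0" for H
    using reduction_inverse_system[OF assms(1,2,4,5) F[OF order_refl] assms(7,8) that]
    by (auto simp: submodule_generated_singleton)
  have down: "act (z ^ k) (F (l + k)) = F l" if "l \<ge> 1" for k l
  proof (induction k)
    case (Suc k)
    have "act z (F (l + Suc k)) = F (l + k)" using assms(6) that by simp
    with Suc show ?case by (simp add: act_mult mult.commute[of z])
  qed simp
  have down0: "act (z ^ l) (F l) = 0" if "l \<ge> 1" for l
  proof -
    obtain k where k: "l = 1 + k" using \<open>l \<ge> 1\<close> le_Suc_ex by blast
    have "act (z ^ l) (F l) = act z (act (z ^ k) (F (1 + k)))" by (simp add: k act_mult)
    also have "\<dots> = 0" using down[of 1 k] assms(7) by simp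
    finally show ?thesis .
  qed
  let ?M = "submodule_generated {F l | l. l \<ge> 1}"
  have FM: "F l \<in> ?M" if "l \<ge> 1" for l
  proof (rule subsetD[OF submodule_generated_superset])
    show "F l \<in> {F l | l. l \<ge> 1}" using that by (intro CollectI exI[of _ l] conjI refl)
  qed
  have gen: "H \<in> ?M" if "H \<in> inverse_system I" "act (z ^ l) H = 0" for H l
    using that
  proof (induction l arbitrary: H)
    case 0
    then show ?case using act_mem_submodule_generated[OF FM[OF order_refl], of 0] by simp
  next
    case (Suc l)
    have "act z (act (z ^ l) H) = 0" using Suc.prems(2) by (simp add: act_mult)
    then have "act (z ^ l) H \<in> submodule_generated {F 1}"
      using Suc.prems(1) by (intro base inv(1))
    then obtain a where "act (z ^ l) H = act a (F 1)" by (auto simp: submodule_generated_singleton)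
    also have "F 1 = act (z ^ l) (F (1 + l))" using down[of 1 l] by simp
    finally have a: "act (z ^ l) H = act (z ^ l) (act a (F (1 + l)))" by (simp add: act_commute)
    have "act (z ^ l) (H - act a (F (1 + l))) = 0"
      using a act_add_right[of "z ^ l" "H - act a (F (1 + l))" "act a (F (1 + l))"] by simp
    then have "H - act a (F (1 + l)) \<in> ?M"
      using Suc.prems(1) by (intro Suc.IH inv F) auto
    moreover have "act a (F (1 + l)) \<in> ?M"
      by (rule act_mem_submodule_generated, rule FM) simp
    ultimately have "(H - act a (F (1 + l))) + act a (F (1 + l)) \<in> ?M"
      unfolding submodule_generated_def by (rule module.span_add[OF module_act])
    then show ?case by simp
  qed
  have z0: "Poly_Mapping.lookup z 0 = 0" using assms(4) lookup_zero_homogeneous by auto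
  have M: "?M = inverse_system I"
  proof
    show "?M \<subseteq> inverse_system I" using F by (intro submodule_generated_subset_inverse_system) auto
    show "inverse_system I \<subseteq> ?M"
    proof
      fix H assume H: "H \<in> inverse_system I"
      obtain l where "act (z ^ l) H = 0" using act_power_eq_0[OF z0] .
      with H show "H \<in> ?M" by (rule gen)
    qed
  qed
  have "(\<lambda>f. act f (F (l + 1))) ` annihilator (submodule_generated {F l}) = submodule_generated {F 1}"
    if l: "l \<ge> 1" for l
  proof
    show "(\<lambda>f. act f (F (l + 1))) ` annihilator (submodule_generated {F l}) \<subseteq> submodule_generated {F 1}"
    proof clarify
      fix f assume "f \<in> annihilator (submodule_generated {F l})"
      then have "act f (F l) = 0"
        using submodule_generated_superset[of "{F l}"] by (auto simp: annihilator_def)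
      moreover have "act z (F (l + 1)) = F l" using assms(6) l by simp
      ultimately have "act z (act f (F (l + 1))) = 0" by (simp add: act_commute[of z])
      then show "act f (F (l + 1)) \<in> submodule_generated {F 1}"
        using F by (intro base inv(1)) auto
    qed
    show "submodule_generated {F 1} \<subseteq> (\<lambda>f. act f (F (l + 1))) ` annihilator (submodule_generated {F l})"
    proof
      fix G assume "G \<in> submodule_generated {F 1}"
      then obtain a where "G = act a (F 1)" by (auto simp: submodule_generated_singleton)
      then have "G = act (a * z ^ l) (F (l + 1))"
        using down[of 1 l] by (simp add: act_mult add.commute)
      moreover have "a * z ^ l \<in> annihilator (submodule_generated {F l})"
      proof -
        have "act (a * z ^ l) (act b (F l)) = 0" for b
          using down0[OF l] act_commute[of "z ^ l" b] by (simp add: act_mult)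
        then show ?thesis by (auto simp: annihilator_def submodule_generated_singleton)
      qed
      ultimately show "G \<in> (\<lambda>f. act f (F (l + 1))) ` annihilator (submodule_generated {F l})" by blast
    qed
  qed
  then have "G_admissible z F" using assms(4,6,7) by (simp add: G_admissible_def)
  with M show ?thesis by (intro conjI exI[of _ "\<lambda>_. 1"]) simp_all
qed

end
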